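(* Let $n\ge 2$ be even and consider the pseudo-Euclidean space $\mathbb{R}^{1,n-1}$ with Cartesian coordinates $x^1,\dots,x^n$, a smooth tetrad $y^\mu_a$, the genvector $h^\mu=y^\mu_a e^a$ and the operator $\eth=h^\mu\partial_\mu$. Let $$\eth\phi+Q(\phi)=f,\qquad Q(\phi)=\sum_{j=1}^{N}A_j\,\phi\,B_j,$$ be a complex covariantly equipped system of equations of first order in $\mathbb{R}^{1,n-1}$, where the known genforms $A_j,B_j$ depend smoothly on $x$. Then this system can be written in the form of a complex Friedrichs symmetric hyperbolic system of equations of first order.
   Context: Clifford algebra. $\mathcal{C}\ell(1,n-1)$ is the real Clifford algebra with identity $e$ and generators $e^1,\dots,e^n$ satisfying $e^ae^b+e^be^a=2\eta^{ab}e$, where $\eta=\mathrm{diag}(1,-1,\dots,-1)$. $\mathcal{C}\ell_k(1,n-1)$ is the subspace of grade $k$ elements (span of products $e^{a_1}\cdots e^{a_k}$, $a_1<\dots<a_k$). The generators do not depend on $x$. Summation over repeated indices is understood and $\partial_\mu=\partial/\partial x^\mu$. Tetrad and genvector. A (smooth) tetrad is a family of smooth real functions $y^\mu_a$ on $\mathbb{R}^{1,n-1}$ ($\mu,a=1,\dots,n$) with $y^\mu_a y^\nu_b\eta^{ab}=\eta^{\mu\nu}$. The genvector is $h^\mu=y^\mu_a e^a$; hence $h^\mu h^\nu+h^\nu h^\mu=2\eta^{\mu\nu}e$. Genforms. A (complexified) genform $U\in\mathbb{C}\otimes\Lambda^{[h]}(\mathbb{R}^{1,n-1})$ is an expression $U=ue+\sum_{k=1}^n\frac1{k!}u_{\mu_1\dots\mu_k}h^{\mu_1}\wedge\dots\wedge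 h^{\mu_k}$, where the $u_{\mu_1\dots\mu_k}$ are complex antisymmetric covariant tensor fields depending on $x$ and $h^{\mu_1}\wedge\dots\wedge h^{\mu_k}$ is the antisymmetrized Clifford product. Equivalently, $U$ is a function of $x$ with values in $\mathbb{C}\otimes\mathcal{C}\ell(1,n-1)$; genforms are multiplied pointwise by the Clifford product and differentiated as Clifford-algebra-valued functions. $\Lambda^{[h]}_k$ is the set of genforms with values in $\mathcal{C}\ell_k$; $\Lambda^{[h]}_{\rm even}=\bigoplus_{k\text{ even}}\Lambda^{[h]}_k$ and $\Lambda^{[h]}_{\rm odd}=\bigoplus_{k\text{ odd}}\Lambda^{[h]}_k$. Covariantly equipped systems. A complex covariantly equipped system of equations of first order is a system $\eth\phi+Q(\phi)=f$ with unknown genform $\phi$, known genform $f$, and $Q(\phi)=\sum_{j=1}^N A_j\phi B_j$, where $A_j,B_j$ are known complexified genforms independent of $\phi$, in one of the following three cases: (i) $\phi,f,Q(\phi)\in\mathbb{C}\otimes\Lambda^{[h]}$; (ii) $\phi\in\mathbb{C}\otimes\Lambda^{[h]}_{\rm even}$ and $f,Q(\phi)\in\mathbb{C}\otimes\Lambda^{[h]}_{\rm odd}$; (iii) $\phi\in\mathbb{C}\otimes\Lambda^{[h]}_{\rm odd}$ and $f,Q(\phi)\in\mathbb{C}\otimes\Lambda^{[h]}_{\rm even}$. In cases (ii), (iii), for each $j$ one of $A_j,B_j$ is even and the other is odd. Friedrichs systems. A complex Friedrichs symmetric hyperbolic system of first order is a system $\sum_{i=1}^n H_i\partial_i u+Pu=g$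 for an unknown column $u=u(x)\in\mathbb{C}^M$, where $g=g(x)\in\mathbb{C}^M$ is a known column, $H_1,\dots,H_n,P$ are complex $M\times M$ matrices depending smoothly on $x$, all $H_i$ are Hermitian, and $H_1$ is positive definite at every $x$. "Can be written in the form of" means the following. Let $V$ be the complex vector space in which $\phi$ takes values and $W$ the one in which the equation takes values ($V=W=\mathbb{C}\otimes\mathcal{C}\ell(1,n-1)$ in case (i); the even and odd parts, respectively, in case (ii); the odd and even parts, respectively, in case (iii)). There are a linear isomorphism $T:V\to\mathbb{C}^M$ independent of $x$ and linear isomorphisms $L(x):W\to\mathbb{C}^M$ depending smoothly on $x$ such that, with $u=T\phi$, the expression $L(x)\big(\eth\phi+Q(\phi)-f\big)$ equals $\sum_i H_i\partial_iu+Pu-g$ with $H_i,P,g$ as in the definition of a Friedrichs system. *)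

theory Defs
  imports "HOL-Analysis.Analysis" "Jordan_Normal_Form.Schur_Decomposition"
begin

no_notation vec_index (infixl "$" 100)

type_synonym 'n point = "(real, 'n) Finite_Cartesian_Product.vec"

section \<open>Smooth functions and partial derivatives\<close>

primrec continuously_differentiable ::
  "nat \<Rightarrow> ('a::real_normed_vector \<Rightarrow> 'b::real_normed_vector) \<Rightarrow> bool" where
  "continuously_differentiable 0 f \<longleftrightarrow> continuous_on UNIV f"
| "continuously_differentiable (Suc k) f \<longleftrightarrow>
     f differentiable_on UNIV \<and>
     (\<forall>v. continuously_differentiable k (\<lambda>x. frechet_derivative f (at x) v))"

definition smooth :: "('a::real_normed_vector \<Rightarrow> 'b::real_normed_vector) \<Rightarrow> bool" where
  "smooth f \<longleftrightarrow> (\<forall>k. continuously_differentiable k f)"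

definition partial_deriv ::
  "'n::finite \<Rightarrow> ('n point \<Rightarrow> 'b::real_normed_vector) \<Rightarrow> 'n point \<Rightarrow> 'b" where
  "partial_deriv \<mu> f x = frechet_derivative f (at x) (axis \<mu> 1)"

section \<open>The complexified Clifford algebra of signature (1, n-1)\<close>

text \<open>The indices \<open>1, \<dots>, n\<close> are the elements of a finite linearly ordered type \<open>'n\<close>; its least
  element plays the role of the index 1.\<close>

abbreviation first_index :: "'n::{finite,linorder}" where
  "first_index \<equiv> Min UNIV"

definition eta :: "'n::{finite,linorder} \<Rightarrow> 'n \<Rightarrow> real" where
  "eta a b = (if a = b then (if a = first_index then 1 else - 1) else 0)"

text \<open>A multivector \<open>U\<close> has the coefficient \<open>U $ A\<close> at the basis blade \<open>e\<^sup>A\<close>, the product of the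
  generators with index in \<open>A\<close> in increasing order (lemma \<open>generator_product_eq\<close>).\<close>

type_synonym 'n multivector = "complex ^ ('n set)"

text \<open>In \<open>e\<^sup>A e\<^sup>B\<close>, sorting the generators costs a sign for each pair \<open>a \<in> A\<close>, \<open>b \<in> B\<close> with \<open>b < a\<close>,
  and each common index \<open>a\<close> contributes \<open>e\<^sup>a e\<^sup>a = \<eta>\<^sup>a\<^sup>a e\<close>. What remains is the blade of the symmetric
  difference of \<open>A\<close> and \<open>B\<close>.\<close>

definition gen_sign :: "'n::{finite,linorder} \<Rightarrow> 'n \<Rightarrow> real" where
  "gen_sign a b = (if b < a then - 1 else if a = b then eta a a else 1)"

definition blade_sign :: "'n::{finite,linorder} set \<Rightarrow> 'n set \<Rightarrow> real" where
  "blade_sign A B = (\<Prod>a\<in>A. \<Prod>b\<in>B. gen_sign a b)"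

definition cliff_mult ::
  "'n::{finite,linorder} multivector \<Rightarrow> 'n multivector \<Rightarrow> 'n multivector" (infixl "\<star>" 70) where
  "U \<star> V = (\<chi> C. \<Sum>A\<in>UNIV. of_real (blade_sign A (sym_diff A C)) * U $ A * V $ (sym_diff A C))"

definition cliff_one :: "'n::{finite,linorder} multivector" where
  "cliff_one = axis {} 1"

definition generator :: "'n::{finite,linorder} \<Rightarrow> 'n multivector" where
  "generator a = axis {a} 1"

definition generator_product :: "'n::{finite,linorder} set \<Rightarrow> 'n multivector" where
  "generator_product A = foldr (\<lambda>a U. generator a \<star> U) (sorted_list_of_set A) cliff_one"

definition cliff_grade :: "nat \<Rightarrow> 'n::{finite,linorder} multivector set" where
  "cliff_grade k = vec.span {generator_product A | A. card A = k}"

definition cliff_even :: "'n::{finite,linorder} multivector set" where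
  "cliff_even = vec.span (\<Union>k\<in>{k. even k}. cliff_grade k)"

definition cliff_odd :: "'n::{finite,linorder} multivector set" where
  "cliff_odd = vec.span (\<Union>k\<in>{k. odd k}. cliff_grade k)"

text \<open>The product above makes the multivectors an associative unital complex algebra with the
  defining relations of the Clifford algebra, in which the ordered products of generators form a
  basis.\<close>

lemma prod_sym_diff:
  fixes f :: "'a \<Rightarrow> real"
  assumes "finite A" "finite B" "\<And>a. f a * f a = 1"
  shows "prod f (sym_diff A B) = prod f A * prod f B"
proof -
  have A: "prod f A = prod f (A - B) * prod f (A \<inter> B)"
    using assms by (metis Int_Diff_Un Int_Diff_disjoint Int_commute finite_Diff finite_Int
        mult.commute prod.union_disjoint)
  have B: "prod f B = prod f (B - A) * prod f (A \<inter> B)"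
    using assms by (metis Int_Diff_Un Int_Diff_disjoint Int_commute finite_Diff finite_Int
        mult.commute prod.union_disjoint)
  have I: "prod f (A \<inter> B) * prod f (A \<inter> B) = 1"
    by (simp add: assms(3) flip: prod.distrib)
  have "prod f (sym_diff A B) = prod f (A - B) * prod f (B - A)"
    using assms by (intro prod.union_disjoint) auto
  also have "\<dots> = prod f (A - B) * prod f (B - A) * (prod f (A \<inter> B) * prod f (A \<inter> B))"
    by (simp add: I)
  also have "\<dots> = prod f A * prod f B"
    by (simp add: A B)
  finally show ?thesis .
qed

lemma gen_sign_square: "gen_sign a b * gen_sign a b = 1"
  by (simp add: gen_sign_def eta_def)

lemma blade_sign_sym_diff_right:
  "blade_sign A (sym_diff B C) = blade_sign A B * blade_sign A C"
  by (simp add: blade_sign_def prod_sym_diff gen_sign_square prod.distrib)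

lemma blade_sign_sym_diff_left:
  "blade_sign (sym_diff A B) C = blade_sign A C * blade_sign B C"
proof -
  have "(\<Prod>b\<in>C. gen_sign a b) * (\<Prod>b\<in>C. gen_sign a b) = 1" for a
    by (simp add: gen_sign_square flip: prod.distrib)
  then show ?thesis
    by (simp add: blade_sign_def prod_sym_diff)
qed

lemma cliff_mult_nth:
  "(U \<star> V) $ C = (\<Sum>A\<in>UNIV. of_real (blade_sign A (sym_diff A C)) * U $ A * V $ (sym_diff A C))"
  by (simp add: cliff_mult_def)

lemma cliff_mult_assoc:
  fixes U V W :: "'a::{finite,linorder} multivector"
  shows "(U \<star> V) \<star> W = U \<star> (V \<star> W)"
proof -
  have "((U \<star> V) \<star> W) $ D = (U \<star> (V \<star> W)) $ D" for D
  proof -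
    have "((U \<star> V) \<star> W) $ D = (\<Sum>C\<in>UNIV. \<Sum>A\<in>UNIV. of_real (blade_sign C (sym_diff C D)) *
        (of_real (blade_sign A (sym_diff A C)) * U $ A * V $ (sym_diff A C)) * W $ (sym_diff C D))"
      by (simp add: cliff_mult_nth sum_distrib_left sum_distrib_right)
    also have "\<dots> = (\<Sum>A\<in>UNIV. \<Sum>C\<in>UNIV. of_real (blade_sign C (sym_diff C D)) *
        (of_real (blade_sign A (sym_diff A C)) * U $ A * V $ (sym_diff A C)) * W $ (sym_diff C D))"
      by (rule sum.swap)
    also have "\<dots> = (\<Sum>A\<in>UNIV. \<Sum>B\<in>UNIV.
        of_real (blade_sign (sym_diff A B) (sym_diff (sym_diff A B) D)) *
        (of_real (blade_sign A B) * U $ A * V $ B) * W $ (sym_diff (sym_diff A B) D))"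
    proof (rule sum.cong[OF refl])
      fix A :: "'a set"
      have *: "sym_diff A (sym_diff A C) = C" for C by blast
      show "(\<Sum>C\<in>UNIV. of_real (blade_sign C (sym_diff C D)) *
        (of_real (blade_sign A (sym_diff A C)) * U $ A * V $ (sym_diff A C)) * W $ (sym_diff C D))
        = (\<Sum>B\<in>UNIV.
        of_real (blade_sign (sym_diff A B) (sym_diff (sym_diff A B) D)) *
        (of_real (blade_sign A B) * U $ A * V $ B) * W $ (sym_diff (sym_diff A B) D))"
        by (rule sum.reindex_bij_witness[of _ "sym_diff A" "sym_diff A"]) (simp_all only: * UNIV_I)
    qed
    also have "\<dots> = (\<Sum>A\<in>UNIV. \<Sum>B\<in>UNIV. of_real (blade_sign A (sym_diff A D)) * U $ A *
        (of_real (blade_sign B (sym_diff B (sym_diff A D))) * V $ B * W $ (sym_diff B (sym_diff A D))))"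
    proof (intro sum.cong refl)
      fix A B :: "'a set"
      have 1: "sym_diff (sym_diff A B) D = sym_diff B (sym_diff A D)" by blast
      have sq: "blade_sign A B * blade_sign A B = 1"
        by (simp add: blade_sign_def gen_sign_square flip: prod.distrib)
      have "blade_sign (sym_diff A B) (sym_diff B (sym_diff A D)) * blade_sign A B
          = (blade_sign A B * blade_sign A B) *
            (blade_sign A (sym_diff A D) * blade_sign B (sym_diff B (sym_diff A D)))"
        unfolding blade_sign_sym_diff_left[of A B]
          blade_sign_sym_diff_right[of A B "sym_diff A D"] by (simp only: ac_simps)
      then have 2: "blade_sign (sym_diff A B) (sym_diff B (sym_diff A D)) * blade_sign A B
          = blade_sign A (sym_diff A D) * blade_sign B (sym_diff B (sym_diff A D))"
        by (simp only: sq mult_1)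
      have 3: "complex_of_real (blade_sign (sym_diff A B) (sym_diff B (sym_diff A D))) *
          of_real (blade_sign A B) = of_real (blade_sign A (sym_diff A D)) *
          of_real (blade_sign B (sym_diff B (sym_diff A D)))"
        by (simp only: 2 flip: of_real_mult)
      have "complex_of_real (blade_sign (sym_diff A B) (sym_diff B (sym_diff A D))) *
        (of_real (blade_sign A B) * U $ A * V $ B) * W $ (sym_diff B (sym_diff A D))
        = (complex_of_real (blade_sign (sym_diff A B) (sym_diff B (sym_diff A D))) *
          of_real (blade_sign A B)) * (U $ A * V $ B * W $ (sym_diff B (sym_diff A D)))"
        by (simp only: ac_simps)
      also have "\<dots> = of_real (blade_sign A (sym_diff A D)) * U $ A *
        (of_real (blade_sign B (sym_diff B (sym_diff A D))) * V $ B * W $ (sym_diff B (sym_diff A D)))"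
        unfolding 3 by (simp only: ac_simps)
      finally show "complex_of_real (blade_sign (sym_diff A B) (sym_diff (sym_diff A B) D)) *
        (of_real (blade_sign A B) * U $ A * V $ B) * W $ (sym_diff (sym_diff A B) D)
        = of_real (blade_sign A (sym_diff A D)) * U $ A *
        (of_real (blade_sign B (sym_diff B (sym_diff A D))) * V $ B * W $ (sym_diff B (sym_diff A D)))"
        unfolding 1 .
    qed
    also have "\<dots> = (U \<star> (V \<star> W)) $ D"
      by (simp only: cliff_mult_nth sum_distrib_left)
    finally show ?thesis .
  qed
  then show ?thesis by (simp add: Finite_Cartesian_Product.vec_eq_iff)
qed

lemma cliff_mult_add_left: "(U + V) \<star> W = U \<star> W + V \<star> W"
  by (simp add: Finite_Cartesian_Product.vec_eq_iff cliff_mult_nth ring_distribs sum.distrib)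

lemma cliff_mult_add_right: "U \<star> (V + W) = U \<star> V + U \<star> W"
  by (simp add: Finite_Cartesian_Product.vec_eq_iff cliff_mult_nth ring_distribs sum.distrib)

lemma cliff_mult_scale_left: "(c *s U) \<star> V = c *s (U \<star> V)"
  by (simp add: Finite_Cartesian_Product.vec_eq_iff cliff_mult_nth sum_distrib_left mult.assoc mult.left_commute)

lemma cliff_mult_scale_right: "U \<star> (c *s V) = c *s (U \<star> V)"
  by (simp add: Finite_Cartesian_Product.vec_eq_iff cliff_mult_nth sum_distrib_left mult.assoc mult.left_commute)

lemma cliff_mult_axis:
  "axis A 1 \<star> axis B 1 = of_real (blade_sign A B) *s axis (sym_diff A B) 1"
proof -
  have "(axis A 1 \<star> axis B 1) $ C = (of_real (blade_sign A B) *s axis (sym_diff A B) 1) $ C" for C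
  proof -
    have "(axis A 1 \<star> axis B 1) $ C = (\<Sum>A'\<in>UNIV. if A' = A then
        of_real (blade_sign A (sym_diff A C)) * axis B 1 $ (sym_diff A C) else (0::complex))"
      unfolding cliff_mult_nth by (intro sum.cong) (auto simp: axis_def)
    also have "\<dots> = of_real (blade_sign A (sym_diff A C)) * axis B 1 $ (sym_diff A C)"
      by simp
    also have "\<dots> = (of_real (blade_sign A B) *s axis (sym_diff A B) 1) $ C"
    proof (cases "C = sym_diff A B")
      case True
      then have "sym_diff A C = B" by blast
      with True show ?thesis by (simp add: axis_def)
    next
      case False
      then have "sym_diff A C \<noteq> B" by blast
      with False show ?thesis by (simp add: axis_def)
    qed
    finally show ?thesis .
  qed
  then show ?thesis by (simp add: Finite_Cartesian_Product.vec_eq_iff)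
qed

lemma cliff_mult_one_left [simp]:
  fixes U :: "'a::{finite,linorder} multivector"
  shows "cliff_one \<star> U = U"
proof -
  have "(cliff_one \<star> U) $ C = U $ C" for C
  proof -
    have "(cliff_one \<star> U) $ C = (\<Sum>A\<in>(UNIV :: 'a set set). if A = {} then U $ C else 0)"
      unfolding cliff_mult_nth cliff_one_def
      by (intro sum.cong) (auto simp: axis_def blade_sign_def)
    then show ?thesis by simp
  qed
  then show ?thesis by (simp add: Finite_Cartesian_Product.vec_eq_iff)
qed

lemma cliff_mult_one_right [simp]:
  fixes U :: "'a::{finite,linorder} multivector"
  shows "U \<star> cliff_one = U"
proof -
  have "(U \<star> cliff_one) $ C = U $ C" for C
  proof -
    have "(U \<star> cliff_one) $ C = (\<Sum>A\<in>UNIV. if A = C then U $ C else 0)"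
      unfolding cliff_mult_nth cliff_one_def
    proof (rule sum.cong[OF refl])
      fix A :: "'a set"
      have "sym_diff A C = {} \<longleftrightarrow> A = C" by blast
      then show "of_real (blade_sign A (sym_diff A C)) * U $ A * axis {} 1 $ sym_diff A C
          = (if A = C then U $ C else 0)"
        by (auto simp: axis_def blade_sign_def)
    qed
    then show ?thesis by simp
  qed
  then show ?thesis by (simp add: Finite_Cartesian_Product.vec_eq_iff)
qed

lemma generator_anticommute:
  "generator a \<star> generator b + generator b \<star> generator a = of_real (2 * eta a b) *s cliff_one"
proof (cases "a = b")
  case True
  then have "blade_sign {a} {b} = eta a b" "blade_sign {b} {a} = eta a b"
      "sym_diff {a} {b} = {}" "sym_diff {b} {a} = {}"
    by (auto simp: blade_sign_def gen_sign_def)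
  then show ?thesis
    unfolding generator_def cliff_mult_axis cliff_one_def
    by (simp only: vec.scale_left_distrib[symmetric] of_real_add[symmetric] mult_2)
next
  case False
  then have "blade_sign {b} {a} = - blade_sign {a} {b}" "eta a b = 0"
      "sym_diff {b} {a} = sym_diff {a} {b}"
    by (auto simp: blade_sign_def gen_sign_def eta_def)
  then show ?thesis
    unfolding generator_def cliff_mult_axis
    by (simp only: vec.scale_left_distrib[symmetric] of_real_add[symmetric]) simp
qed

lemma generator_product_eq:
  fixes A :: "'a::{finite,linorder} set"
  shows "generator_product A = axis A 1"
proof -
  have "sorted xs \<Longrightarrow> distinct xs \<Longrightarrow>
    foldr (\<lambda>a U. generator a \<star> U) xs cliff_one = axis (set xs) 1" for xs :: "'a list"
  proof (induction xs)
    case Nil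
    then show ?case by (simp add: cliff_one_def)
  next
    case (Cons a xs)
    then have less: "a < b" if "b \<in> set xs" for b
      using that by (metis distinct.simps(2) order_le_less sorted_simps(2))
    have "gen_sign a b = 1" if "b \<in> set xs" for b
      using less[OF that] by (auto simp: gen_sign_def dest: order_less_asym)
    then have 1: "blade_sign {a} (set xs) = 1"
      by (simp add: blade_sign_def)
    have 2: "sym_diff {a} (set xs) = set (a # xs)"
      using Cons.prems by auto
    have "foldr (\<lambda>a U. generator a \<star> U) xs cliff_one = axis (set xs) 1"
      using Cons by simp
    then have "foldr (\<lambda>a U. generator a \<star> U) (a # xs) cliff_one = axis {a} 1 \<star> axis (set xs) 1"
      by (simp add: generator_def)
    then show ?case
      by (simp only: cliff_mult_axis 1 2 of_real_1 vector_smult_lid)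
  qed
  from this[of "sorted_list_of_set A"] show ?thesis
    by (simp add: generator_product_def)
qed

section \<open>Tetrads and covariantly equipped systems\<close>

text \<open>The value \<open>y \<mu> a x\<close> is the component with upper index \<open>\<mu>\<close> and lower index \<open>a\<close> at the point
  \<open>x\<close>.\<close>

definition smooth_tetrad ::
  "('n::{finite,linorder} \<Rightarrow> 'n \<Rightarrow> 'n point \<Rightarrow> real) \<Rightarrow> bool" where
  "smooth_tetrad y \<longleftrightarrow>
     (\<forall>\<mu> a. smooth (y \<mu> a)) \<and>
     (\<forall>x \<mu> \<nu>. (\<Sum>a\<in>UNIV. \<Sum>b\<in>UNIV. y \<mu> a x * y \<nu> b x * eta a b) = eta \<mu> \<nu>)"

definition genvector ::
  "('n::{finite,linorder} \<Rightarrow> 'n \<Rightarrow> 'n point \<Rightarrow> real) \<Rightarrow> 'n \<Rightarrow> 'n point \<Rightarrow> 'n multivector" where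
  "genvector y \<mu> x = (\<Sum>a\<in>UNIV. of_real (y \<mu> a x) *s generator a)"

definition eth ::
  "('n::{finite,linorder} \<Rightarrow> 'n \<Rightarrow> 'n point \<Rightarrow> real) \<Rightarrow>
   ('n point \<Rightarrow> 'n multivector) \<Rightarrow> 'n point \<Rightarrow> 'n multivector" where
  "eth y \<phi> x = (\<Sum>\<mu>\<in>UNIV. genvector y \<mu> x \<star> partial_deriv \<mu> \<phi> x)"

text \<open>A complexified genform is a function of type \<open>'n point \<Rightarrow> 'n multivector\<close>.\<close>

definition genform_in ::
  "'n::{finite,linorder} multivector set \<Rightarrow> ('n point \<Rightarrow> 'n multivector) \<Rightarrow> bool" where
  "genform_in V U \<longleftrightarrow> (\<forall>x. U x \<in> V)"

definition Q_op ::
  "nat \<Rightarrow> (nat \<Rightarrow> 'n point \<Rightarrow> 'n::{finite,linorder} multivector) \<Rightarrow>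
   (nat \<Rightarrow> 'n point \<Rightarrow> 'n multivector) \<Rightarrow>
   ('n point \<Rightarrow> 'n multivector) \<Rightarrow> 'n point \<Rightarrow> 'n multivector" where
  "Q_op N A B \<phi> x = (\<Sum>j=1..N. A j x \<star> \<phi> x \<star> B j x)"

definition opposite_parities ::
  "nat \<Rightarrow> (nat \<Rightarrow> 'n point \<Rightarrow> 'n::{finite,linorder} multivector) \<Rightarrow>
   (nat \<Rightarrow> 'n point \<Rightarrow> 'n multivector) \<Rightarrow> bool" where
  "opposite_parities N A B \<longleftrightarrow> (\<forall>j\<in>{1..N}.
     (genform_in cliff_even (A j) \<and> genform_in cliff_odd (B j)) \<or>
     (genform_in cliff_odd (A j) \<and> genform_in cliff_even (B j)))"

text \<open>\<open>V\<close> is the space of values of the unknown \<open>\<phi>\<close> and \<open>W\<close> that of the values of the equation.\<close>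

definition covariantly_equipped ::
  "'n::{finite,linorder} multivector set \<Rightarrow> 'n multivector set \<Rightarrow>
   nat \<Rightarrow> (nat \<Rightarrow> 'n point \<Rightarrow> 'n multivector) \<Rightarrow>
   (nat \<Rightarrow> 'n point \<Rightarrow> 'n multivector) \<Rightarrow> ('n point \<Rightarrow> 'n multivector) \<Rightarrow> bool" where
  "covariantly_equipped V W N A B f \<longleftrightarrow>
     (V = UNIV \<and> W = UNIV \<or>
      V = cliff_even \<and> W = cliff_odd \<and> opposite_parities N A B \<or>
      V = cliff_odd \<and> W = cliff_even \<and> opposite_parities N A B) \<and>
     genform_in W f \<and>
     (\<forall>\<phi>. genform_in V \<phi> \<longrightarrow> genform_in W (Q_op N A B \<phi>))"

section \<open>Friedrichs symmetric hyperbolic systems\<close>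

definition hermitian_matrix :: "complex Matrix.mat \<Rightarrow> bool" where
  "hermitian_matrix H \<longleftrightarrow> mat_adjoint H = H"

definition positive_definite :: "nat \<Rightarrow> complex Matrix.mat \<Rightarrow> bool" where
  "positive_definite M H \<longleftrightarrow>
     (\<forall>v\<in>carrier_vec M. v \<noteq> 0\<^sub>v M \<longrightarrow> Re ((H *\<^sub>v v) \<bullet>c v) > 0)"

definition smooth_matrix ::
  "nat \<Rightarrow> ('a::real_normed_vector \<Rightarrow> complex Matrix.mat) \<Rightarrow> bool" where
  "smooth_matrix M H \<longleftrightarrow>
     (\<forall>x. H x \<in> carrier_mat M M) \<and> (\<forall>k<M. \<forall>l<M. smooth (\<lambda>x. H x $$ (k, l)))"

definition friedrichs_system ::
  "nat \<Rightarrow> ('n::{finite,linorder} \<Rightarrow> 'n point \<Rightarrow> complex Matrix.mat) \<Rightarrow>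
   ('n point \<Rightarrow> complex Matrix.mat) \<Rightarrow> ('n point \<Rightarrow> complex Matrix.vec) \<Rightarrow> bool" where
  "friedrichs_system M H P g \<longleftrightarrow>
     (\<forall>i. smooth_matrix M (H i)) \<and> smooth_matrix M P \<and> (\<forall>x. g x \<in> carrier_vec M) \<and>
     (\<forall>i x. hermitian_matrix (H i x)) \<and> (\<forall>x. positive_definite M (H first_index x))"

definition column_partial_deriv ::
  "nat \<Rightarrow> 'n::finite \<Rightarrow> ('n point \<Rightarrow> complex Matrix.vec) \<Rightarrow> 'n point \<Rightarrow> complex Matrix.vec" where
  "column_partial_deriv M i u x =
     Matrix.vec M (\<lambda>k. partial_deriv i (\<lambda>z. vec_index (u z) k) x)"

definition friedrichs_expression ::
  "nat \<Rightarrow> ('n::{finite,linorder} \<Rightarrow> 'n point \<Rightarrow> complex Matrix.mat) \<Rightarrow>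
   ('n point \<Rightarrow> complex Matrix.mat) \<Rightarrow> ('n point \<Rightarrow> complex Matrix.vec) \<Rightarrow>
   ('n point \<Rightarrow> complex Matrix.vec) \<Rightarrow> 'n point \<Rightarrow> complex Matrix.vec" where
  "friedrichs_expression M H P g u x =
     finsum_vec TYPE(complex) M (\<lambda>i. H i x *\<^sub>v column_partial_deriv M i u x) UNIV
       + P x *\<^sub>v u x - g x"

definition linear_isomorphism ::
  "'n::{finite,linorder} multivector set \<Rightarrow> nat \<Rightarrow> ('n multivector \<Rightarrow> complex Matrix.vec) \<Rightarrow> bool" where
  "linear_isomorphism V M T \<longleftrightarrow>
     bij_betw T V (carrier_vec M) \<and>
     (\<forall>v\<in>V. \<forall>w\<in>V. T (v + w) = T v + T w) \<and>
     (\<forall>c. \<forall>v\<in>V. T (c *s v) = c \<cdot>\<^sub>v T v)"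

text \<open>The equation of the system is \<open>D \<phi> = 0\<close>, where \<open>D\<close> is an affine differential operator.\<close>

definition writable_as_friedrichs ::
  "'n::{finite,linorder} multivector set \<Rightarrow> 'n multivector set \<Rightarrow>
   (('n point \<Rightarrow> 'n multivector) \<Rightarrow> 'n point \<Rightarrow> 'n multivector) \<Rightarrow> bool" where
  "writable_as_friedrichs V W D \<longleftrightarrow>
     (\<exists>M T L H P g.
        linear_isomorphism V M T \<and>
        (\<forall>x. linear_isomorphism W M (L x)) \<and>
        (\<forall>w\<in>W. \<forall>k<M. smooth (\<lambda>x. vec_index (L x w) k)) \<and>
        friedrichs_system M H P g \<and>
        (\<forall>\<phi>. genform_in V \<phi> \<and> \<phi> differentiable_on UNIV \<longrightarrow>
           (\<forall>x. L x (D \<phi> x) = friedrichs_expression M H P g (T \<circ> \<phi>) x)))"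

end

theory Submission
  imports Defs
begin

text \<open>The Hermitian form for which the blades are orthonormal makes left multiplication by \<open>e\<^sup>1 e\<^sup>a\<close>
  Hermitian for every \<open>a\<close>, hence left multiplication by \<open>e\<^sup>1 h\<^sup>\<mu>\<close> for every tetrad. Moreover
  \<open>(h\<^sup>1)\<^sup>2 = e\<close> says that \<open>(y\<^sup>1\<^sub>1)\<^sup>2\<close> exceeds the sum of the other \<open>(y\<^sup>1\<^sub>a)\<^sup>2\<close> by 1, so by Cauchy--Schwarz
  left multiplication by \<open>e\<^sup>1 h\<^sup>1\<close> is definite with the sign of \<open>y\<^sup>1\<^sub>1\<close>. This sign does not depend on
  \<open>x\<close>, by continuity. Multiplying the system from the left by \<open>\<plusminus>e\<^sup>1\<close>, which exchanges the even and
  the odd part, and taking blade coordinates gives a Friedrichs system.\<close>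

section \<open>Smooth functions\<close>

text \<open>The product rule leaves one factor undifferentiated; this lowers its order so that the
  induction for products applies.\<close>

lemma continuously_differentiable_Suc_imp:
  "continuously_differentiable (Suc k) f \<Longrightarrow> continuously_differentiable k f"
proof (induction k arbitrary: f)
  case 0
  then show ?case by (simp add: differentiable_imp_continuous_on)
next
  case (Suc k)
  then show ?case by (metis continuously_differentiable.simps(2))
qed

lemma continuously_differentiable_const: "continuously_differentiable k (\<lambda>x. c)"
  by (induction k arbitrary: c) simp_all

lemma smooth_const: "smooth (\<lambda>x. c)"
  by (simp add: smooth_def continuously_differentiable_const)

lemma continuously_differentiable_add:
  "continuously_differentiable k f \<Longrightarrow> continuously_differentiable k g \<Longrightarrow>
    continuously_differentiable k (\<lambda>x. f x + g x)"
proof (induction k arbitrary: f g)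
  case 0
  then show ?case by (simp add: continuous_on_add)
next
  case (Suc k)
  then have d: "f differentiable (at x)" "g differentiable (at x)" for x
    by (auto simp: differentiable_on_def)
  have "frechet_derivative (\<lambda>x. f x + g x) (at x) =
      (\<lambda>v. frechet_derivative f (at x) v + frechet_derivative g (at x) v)" for x
    by (rule frechet_derivative_at[symmetric])
      (intro has_derivative_add d[unfolded frechet_derivative_works])
  with Suc d show ?case by (simp add: differentiable_on_def)
qed

text \<open>Here \<open>prod\<close> is the bilinear map of the locale, so one induction serves both
  the Clifford product and scaling by real functions.\<close>

lemma (in bounded_bilinear) continuously_differentiable_prod:
  "continuously_differentiable k f \<Longrightarrow> continuously_differentiable k g \<Longrightarrow>
    continuously_differentiable k (\<lambda>x. prod (f x) (g x))"
proof (induction k arbitrary: f g)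
  case 0
  then show ?case by (simp add: continuous_on)
next
  case (Suc k)
  then have d: "f differentiable (at x)" "g differentiable (at x)" for x
    by (auto simp: differentiable_on_def)
  have D: "((\<lambda>x. prod (f x) (g x)) has_derivative
      (\<lambda>v. prod (f x) (frechet_derivative g (at x) v) + prod (frechet_derivative f (at x) v) (g x))) (at x)" for x
    by (intro FDERIV d[unfolded frechet_derivative_works])
  then have "frechet_derivative (\<lambda>x. prod (f x) (g x)) (at x) =
      (\<lambda>v. prod (f x) (frechet_derivative g (at x) v) + prod (frechet_derivative f (at x) v) (g x))" for x
    by (rule frechet_derivative_at[symmetric])
  moreover have "(\<lambda>x. prod (f x) (g x)) differentiable_on UNIV"
    using D by (auto simp: differentiable_on_def differentiable_def)
  ultimately show ?case
    using Suc continuously_differentiable_Suc_imp[OF Suc.prems(1)]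
      continuously_differentiable_Suc_imp[OF Suc.prems(2)]
    by (auto intro!: continuously_differentiable_add)
qed

lemma smooth_add: "smooth f \<Longrightarrow> smooth g \<Longrightarrow> smooth (\<lambda>x. f x + g x)"
  by (simp add: smooth_def continuously_differentiable_add)

lemma smooth_sum:
  "(\<And>i. i \<in> I \<Longrightarrow> smooth (f i)) \<Longrightarrow> smooth (\<lambda>x. \<Sum>i\<in>I. f i x)"
  by (induction I rule: infinite_finite_induct) (simp_all add: smooth_const smooth_add)

lemma (in bounded_bilinear) smooth_prod:
  "smooth f \<Longrightarrow> smooth g \<Longrightarrow> smooth (\<lambda>x. prod (f x) (g x))"
  by (simp add: smooth_def continuously_differentiable_prod)

lemma smooth_bounded_linear:
  assumes "bounded_linear F" "smooth f"
  shows "smooth (\<lambda>x. F (f x))"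
proof -
  \<comment> \<open>Applying \<open>F\<close> is the bilinear product of the constant 1 with the
    argument, so the product lemma covers linear maps too.\<close>
  have "bounded_bilinear (\<lambda>r v. r *\<^sub>R F v)"
    using bounded_bilinear.comp[OF bounded_bilinear_scaleR bounded_linear_ident assms(1)] .
  from bounded_bilinear.smooth_prod[OF this smooth_const assms(2), of 1] show ?thesis by simp
qed

lemma smooth_imp_continuous_on: "smooth f \<Longrightarrow> continuous_on UNIV f"
  by (metis continuously_differentiable.simps(1) smooth_def)

section \<open>Smoothness of the operations on multivectors\<close>

lemma scaleR_eq_of_real_scale: "r *\<^sub>R (v :: complex ^ 'n) = of_real r *s v"
  by (simp add: Finite_Cartesian_Product.vec_eq_iff) (simp add: scaleR_conv_of_real)

lemma bounded_bilinear_cliff_mult: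
  "bounded_bilinear ((\<star>) :: 'n::{finite,linorder} multivector \<Rightarrow> _)"
  unfolding bilinear_conv_bounded_bilinear[symmetric] bilinear_def
  by (auto intro!: linearI simp: cliff_mult_add_left cliff_mult_add_right cliff_mult_scale_left
      cliff_mult_scale_right scaleR_eq_of_real_scale)

lemma bounded_linear_scale: "bounded_linear ((*s) c :: complex ^ 'n \<Rightarrow> _)"
  unfolding linear_conv_bounded_linear[symmetric]
  by (auto intro!: linearI simp: scaleR_eq_of_real_scale vec.scale_right_distrib mult.commute)

lemma smooth_scale: "smooth f \<Longrightarrow> smooth (\<lambda>x. c *s (f x :: complex ^ 'n))"
  by (rule smooth_bounded_linear[OF bounded_linear_scale])

lemma smooth_scale_const:
  assumes "smooth r"
  shows "smooth (\<lambda>x. of_real (r x) *s (v :: complex ^ 'n))"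
  using bounded_bilinear.smooth_prod[OF bounded_bilinear_scaleR assms smooth_const[of v]]
  by (simp add: scaleR_eq_of_real_scale)

lemma smooth_nth: "smooth f \<Longrightarrow> smooth (\<lambda>x. (f x :: complex ^ 'n) $ i)"
  by (rule smooth_bounded_linear[OF bounded_linear_vec_nth])

section \<open>The Hermitian form that makes the blades orthonormal\<close>

text \<open>Toggling a fixed set of indices is an involution of the blades, which is what reindexing
  sums over blades relies on.\<close>

lemma sym_diff_cancel: "sym_diff A (sym_diff A B) = B"
  by blast

definition hdot :: "complex ^ 'a::finite \<Rightarrow> complex ^ 'a \<Rightarrow> complex" where
  "hdot U V = (\<Sum>A\<in>UNIV. U $ A * cnj (V $ A))"

lemma hdot_add_left: "hdot (U + U') V = hdot U V + hdot U' V"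
  by (simp add: hdot_def ring_distribs sum.distrib)

lemma hdot_scale_left: "hdot (c *s U) V = c * hdot U V"
  by (simp add: hdot_def sum_distrib_left mult.assoc)

lemma hdot_scale_right: "hdot U (c *s V) = cnj c * hdot U V"
  by (simp add: hdot_def sum_distrib_left mult_ac)

lemma hdot_sum_left: "hdot (\<Sum>i\<in>I. F i) V = (\<Sum>i\<in>I. hdot (F i) V)"
  by (induction I rule: infinite_finite_induct) (simp_all add: hdot_add_left, simp_all add: hdot_def)

lemma hdot_cnj: "cnj (hdot U V) = hdot V U"
  by (simp add: hdot_def mult.commute)

lemma hdot_sum_right: "hdot U (\<Sum>i\<in>I. F i) = (\<Sum>i\<in>I. hdot U (F i))"
  by (subst hdot_cnj[symmetric]) (simp add: hdot_sum_left hdot_cnj)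

lemma hdot_axis_right: "hdot U (axis A 1) = U $ A"
proof -
  have "hdot U (axis A 1) = (\<Sum>B\<in>UNIV. if B = A then U $ B else 0)"
    unfolding hdot_def by (intro sum.cong) (auto simp: axis_def)
  then show ?thesis by simp
qed

text \<open>Symmetry is proved for \<open>hdot\<close>, while positivity, norms and Cauchy-Schwarz
  belong to the real inner product; this links the two.\<close>

lemma Re_hdot: "Re (hdot U V) = inner U V"
  by (simp add: hdot_def inner_vec_def inner_complex_def)

lemma axis_cliff_mult_nth:
  fixes U :: "'n::{finite,linorder} multivector"
  shows "(axis A 1 \<star> U) $ C = of_real (blade_sign A (sym_diff A C)) * U $ sym_diff A C"
proof -
  have "(axis A 1 \<star> U) $ C =
      (\<Sum>B\<in>UNIV. if B = A then of_real (blade_sign B (sym_diff B C)) * U $ sym_diff B C else 0)"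
    unfolding cliff_mult_nth by (intro sum.cong) (auto simp: axis_def)
  then show ?thesis by simp
qed

text \<open>Multiplication by \<open>generator a\<close> permutes the orthonormal blades up to sign,
  so its adjoint is its inverse, which is \<open>eta a a\<close> times itself.\<close>

lemma hdot_generator:
  fixes U V :: "'n::{finite,linorder} multivector"
  shows "hdot (generator a \<star> U) V = of_real (eta a a) * hdot U (generator a \<star> V)"
proof -
  \<comment> \<open>Toggling \<open>a\<close> in the second factor changes the sign by
    \<open>gen_sign a a\<close>.\<close>
  have s: "blade_sign {a} (sym_diff {a} C) = eta a a * blade_sign {a} C" for C
    unfolding blade_sign_sym_diff_right by (simp add: blade_sign_def gen_sign_def)
  have e: "eta a a * eta a a = 1"
    by (simp add: eta_def)
  have "hdot (generator a \<star> U) V =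
      (\<Sum>C\<in>UNIV. of_real (blade_sign {a} (sym_diff {a} C)) * U $ sym_diff {a} C * cnj (V $ C))"
    by (simp only: hdot_def generator_def axis_cliff_mult_nth)
  also have "\<dots> = (\<Sum>C\<in>UNIV. of_real (blade_sign {a} C) * U $ C * cnj (V $ sym_diff {a} C))"
    by (rule sum.reindex_bij_witness[of _ "sym_diff {a}" "sym_diff {a}"])
      (simp_all only: sym_diff_cancel UNIV_I)
  also have "\<dots> = (\<Sum>C\<in>UNIV. of_real (eta a a) *
      (U $ C * cnj (of_real (eta a a * blade_sign {a} C) * V $ sym_diff {a} C)))"
  proof (intro sum.cong refl)
    fix C
    have "of_real (eta a a) * (U $ C * cnj (of_real (eta a a * blade_sign {a} C) * V $ sym_diff {a} C))
      = of_real (eta a a * eta a a) * (of_real (blade_sign {a} C) * U $ C * cnj (V $ sym_diff {a} C))"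
      by (simp only: of_real_mult complex_cnj_mult complex_cnj_complex_of_real mult_ac)
    then show "of_real (blade_sign {a} C) * U $ C * cnj (V $ sym_diff {a} C) = of_real (eta a a) *
      (U $ C * cnj (of_real (eta a a * blade_sign {a} C) * V $ sym_diff {a} C))"
      by (simp only: e of_real_1 mult_1)
  qed
  also have "\<dots> = of_real (eta a a) * hdot U (generator a \<star> V)"
    by (simp only: hdot_def generator_def axis_cliff_mult_nth s sum_distrib_left)
  finally show ?thesis .
qed

section \<open>Left multiplication by vectors: relations, symmetry and definiteness\<close>

lemma cliff_mult_sum_left: "(\<Sum>i\<in>I. F i) \<star> U = (\<Sum>i\<in>I. F i \<star> U)"
  using bounded_bilinear.sum_left[OF bounded_bilinear_cliff_mult] .

lemma cliff_mult_sum_right: "U \<star> (\<Sum>i\<in>I. F i) = (\<Sum>i\<in>I. U \<star> F i)"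
  using bounded_bilinear.sum_right[OF bounded_bilinear_cliff_mult] .

lemma cliff_mult_minus_right: "U \<star> (- V) = - (U \<star> V)"
  using bounded_bilinear.minus_right[OF bounded_bilinear_cliff_mult] .

lemma generator_anticommute_mult:
  "generator a \<star> (generator b \<star> U) =
    of_real (2 * eta a b) *s U - generator b \<star> (generator a \<star> U)"
  using arg_cong[where f = "\<lambda>X. X \<star> U", OF generator_anticommute[of a b]]
  by (simp add: cliff_mult_add_left cliff_mult_assoc cliff_mult_scale_left eq_diff_eq)

abbreviation e1 :: "'n::{finite,linorder} multivector" where
  "e1 \<equiv> generator first_index"

lemma e1_e1: "e1 \<star> (e1 \<star> U) = U"
proof -
  have "of_real 2 *s (e1 \<star> (e1 \<star> U)) = of_real 2 *s U"
    using generator_anticommute_mult[of first_index first_index U]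
    by (simp add: eta_def Finite_Cartesian_Product.vec_eq_iff)
  then show ?thesis by (simp add: Finite_Cartesian_Product.vec_eq_iff)
qed

lemma hdot_e1: "hdot (e1 \<star> U) V = hdot U (e1 \<star> V)"
  using hdot_generator[of first_index] by (simp add: eta_def)

text \<open>The Feynman slash of a real covector \<open>c\<close>. At a fixed point each genvector
  component has this form, so the estimates below are purely algebraic.\<close>

definition slash :: "('n::{finite,linorder} \<Rightarrow> real) \<Rightarrow> 'n multivector" where
  "slash c = (\<Sum>a\<in>UNIV. of_real (c a) *s generator a)"

lemma genvector_eq_slash: "genvector y \<mu> x = slash (\<lambda>a. y \<mu> a x)"
  by (simp add: genvector_def slash_def)

lemma slash_mult: "slash c \<star> U = (\<Sum>a\<in>UNIV. of_real (c a) *s (generator a \<star> U))"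
  by (simp add: slash_def cliff_mult_sum_left cliff_mult_scale_left)

text \<open>Left multiplication by \<open>e\<^sup>a\<close> is skew for
  \<open>a \<noteq> 1\<close>, but \<open>e\<^sup>a\<close> anticommutes with \<open>e\<^sup>1\<close>.\<close>

lemma hdot_e1_slash: "hdot (e1 \<star> (slash c \<star> U)) V = hdot U (e1 \<star> (slash c \<star> V))"
proof -
  have "hdot (e1 \<star> (generator a \<star> U)) V = hdot U (e1 \<star> (generator a \<star> V))" for a
  proof (cases "a = first_index")
    case True
    then show ?thesis by (simp add: e1_e1)
  next
    case False
    have "hdot (e1 \<star> (generator a \<star> U)) V = of_real (eta a a) * hdot U (generator a \<star> (e1 \<star> V))"
      unfolding hdot_e1 by (rule hdot_generator)
    also have "generator a \<star> (e1 \<star> V) = (- 1) *s (e1 \<star> (generator a \<star> V))"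
      using generator_anticommute_mult[of a first_index V] False by (simp add: eta_def)
    finally show ?thesis
      using False unfolding hdot_scale_right by (simp add: eta_def)
  qed
  \<comment> \<open>The coefficients \<open>c a\<close> are real, so conjugation in the second
    argument of \<open>hdot\<close> does not change them.\<close>
  then show ?thesis
    by (simp add: slash_mult cliff_mult_sum_right cliff_mult_scale_right hdot_sum_left
        hdot_sum_right hdot_scale_left hdot_scale_right)
qed

text \<open>Adding the double sum to its copy with the indices exchanged turns each pair of products
  into an anticommutator, and the off-diagonal terms vanish. This gives twice the claim.\<close>

lemma slash_slash: "slash c \<star> (slash c \<star> U) = of_real (\<Sum>a\<in>UNIV. (c a)\<^sup>2 * eta a a) *s U"
proof -
  let ?g = "\<lambda>a b. of_real (c a * c b) *s (generator a \<star> (generator b \<star> U))"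
  have S': "slash c \<star> (slash c \<star> U) = (\<Sum>a\<in>UNIV. \<Sum>b\<in>UNIV. ?g b a)"
    by (simp add: slash_mult cliff_mult_sum_right cliff_mult_scale_right vec.scale_sum_right mult.commute)
  have S: "slash c \<star> (slash c \<star> U) = (\<Sum>a\<in>UNIV. \<Sum>b\<in>UNIV. ?g a b)"
    unfolding S' by (rule sum.swap)
  have g: "?g a b + ?g b a = of_real (if b = a then 2 * ((c a)\<^sup>2 * eta a a) else 0) *s U" for a b
    unfolding generator_anticommute_mult[of a b]
    by (auto simp: Finite_Cartesian_Product.vec_eq_iff algebra_simps eta_def power2_eq_square)
  have "of_real 2 *s (slash c \<star> (slash c \<star> U)) =
      slash c \<star> (slash c \<star> U) + slash c \<star> (slash c \<star> U)"
    by (simp add: Finite_Cartesian_Product.vec_eq_iff)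
  also have "\<dots> = (\<Sum>a\<in>UNIV. \<Sum>b\<in>UNIV. ?g a b + ?g b a)"
    by (subst S, subst S') (simp only: sum.distrib)
  also have "\<dots> = of_real (\<Sum>a\<in>UNIV. \<Sum>b\<in>UNIV. if b = a then 2 * ((c a)\<^sup>2 * eta a a) else 0) *s U"
    by (simp only: g vec.scale_sum_left of_real_sum)
  also have "\<dots> = of_real 2 *s (of_real (\<Sum>a\<in>UNIV. (c a)\<^sup>2 * eta a a) *s U)"
    by (simp add: sum_distrib_left)
  finally show ?thesis by (simp add: Finite_Cartesian_Product.vec_eq_iff)
qed

text \<open>Without a component along \<open>e1\<close>, \<open>slash c\<close> anticommutes with
  \<open>e1\<close>. Hence \<open>e1\<close> times \<open>slash c\<close> is Hermitian with square
  the sum of the \<open>(c a)\<^sup>2\<close>, so it scales norms by the root of that sum, and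
  Cauchy-Schwarz applies.\<close>

lemma inner_e1_slash_le:
  assumes "c first_index = 0"
  shows "\<bar>inner (e1 \<star> (slash c \<star> U)) U\<bar> \<le> sqrt (\<Sum>a\<in>UNIV. (c a)\<^sup>2) * (norm U)\<^sup>2"
proof -
  let ?r = "\<Sum>a\<in>UNIV. (c a)\<^sup>2"
  have r: "(\<Sum>a\<in>UNIV. (c a)\<^sup>2 * eta a a) = - ?r"
    using assms by (auto simp: eta_def sum_negf[symmetric] intro!: sum.cong)
  have "e1 \<star> (slash c \<star> (e1 \<star> (slash c \<star> U))) = of_real ?r *s U"
  proof -
    have "slash c \<star> (e1 \<star> X) = (- 1) *s (e1 \<star> (slash c \<star> X))" for X
    proof -
      have "of_real (c a) *s (generator a \<star> (e1 \<star> X)) =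
          (- 1) *s (of_real (c a) *s (e1 \<star> (generator a \<star> X)))" for a
        using generator_anticommute_mult[of a first_index X] assms
        by (cases "a = first_index") (simp_all add: eta_def)
      then show ?thesis
        unfolding slash_mult cliff_mult_sum_right cliff_mult_scale_right vec.scale_sum_right by simp
    qed
    then show ?thesis
      by (simp add: cliff_mult_scale_right cliff_mult_minus_right e1_e1 slash_slash r)
  qed
  then have "inner (e1 \<star> (slash c \<star> U)) (e1 \<star> (slash c \<star> U)) = ?r * inner U U"
    by (simp add: Re_hdot[symmetric] hdot_e1_slash hdot_scale_right)
  then have "norm (e1 \<star> (slash c \<star> U)) = sqrt ?r * norm U"
    by (simp add: norm_eq_sqrt_inner real_sqrt_mult)
  then show ?thesis
    using Cauchy_Schwarz_ineq2[of "e1 \<star> (slash c \<star> U)" U]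
    by (simp add: power2_eq_square mult.assoc)
qed

lemma inner_e1_slash_pos:
  fixes c :: "'n::{finite,linorder} \<Rightarrow> real"
  assumes c: "(\<Sum>a\<in>UNIV. (c a)\<^sup>2 * eta a a) = 1" and "U \<noteq> 0"
  shows "sgn (c first_index) * inner (e1 \<star> (slash c \<star> U)) U > 0"
proof -
  \<comment> \<open>Split \<open>c\<close> into its time component \<open>?c\<close> and its spatial
    part \<open>?d\<close>. The former contributes \<open>?c\<close> times the squared norm of
    \<open>U\<close>, which dominates the spatial term.\<close>
  let ?c = "c first_index" and ?d = "c(first_index := 0)"
  let ?r = "\<Sum>a\<in>UNIV. (?d a)\<^sup>2"
  have "(\<Sum>a\<in>UNIV. (c a)\<^sup>2 * eta a a) = ?c\<^sup>2 + (\<Sum>a\<in>UNIV - {first_index}. (c a)\<^sup>2 * eta a a)"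
    by (subst sum.remove[of _ first_index]) (auto simp: eta_def)
  moreover have "(\<Sum>a\<in>UNIV - {first_index}. (c a)\<^sup>2 * eta a a) = - ?r"
    by (subst (2) sum.remove[of _ first_index]) (auto simp: eta_def sum_negf[symmetric] intro!: sum.cong)
  ultimately have "?r < ?c\<^sup>2" using c by simp
  then have r: "sqrt ?r < \<bar>?c\<bar>"
    by (metis real_sqrt_abs real_sqrt_less_iff)
  have "slash c = of_real ?c *s e1 + slash ?d"
  proof -
    have "slash ?d = (\<Sum>a\<in>UNIV - {first_index}. of_real (c a) *s generator a)"
      unfolding slash_def
      by (subst sum.remove[of _ first_index]) (auto intro!: sum.cong)
    then show ?thesis
      unfolding slash_def by (subst sum.remove[of _ first_index]) auto
  qed
  then have "inner (e1 \<star> (slash c \<star> U)) U = ?c * (norm U)\<^sup>2 + inner (e1 \<star> (slash ?d \<star> U)) U"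
    by (simp add: cliff_mult_add_left cliff_mult_add_right cliff_mult_scale_left
        cliff_mult_scale_right e1_e1 Re_hdot[symmetric] hdot_add_left hdot_scale_left)
      (simp add: Re_hdot power2_norm_eq_inner)
  then have "sgn ?c * inner (e1 \<star> (slash c \<star> U)) U =
      \<bar>?c\<bar> * (norm U)\<^sup>2 + sgn ?c * inner (e1 \<star> (slash ?d \<star> U)) U"
    by (simp add: ring_distribs abs_sgn mult_ac)
  moreover have "\<bar>sgn ?c * inner (e1 \<star> (slash ?d \<star> U)) U\<bar> \<le> sqrt ?r * (norm U)\<^sup>2"
  proof -
    have "0 \<le> sqrt ?r" by (simp add: sum_nonneg)
    then have "?c \<noteq> 0" using r by auto
    then have "\<bar>sgn ?c\<bar> = 1" by (simp add: sgn_if)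
    then show ?thesis using inner_e1_slash_le[of ?d U] by (simp add: abs_mult)
  qed
  moreover have "sqrt ?r * (norm U)\<^sup>2 < \<bar>?c\<bar> * (norm U)\<^sup>2"
    using r assms(2) by simp
  ultimately show ?thesis by linarith
qed

section \<open>Matrices of linear maps in the blade basis\<close>

text \<open>A common form for the value spaces in all three cases: \<open>S\<close> consists of all
  index sets, or of those of even or of odd cardinality.\<close>

definition supported :: "'a::finite set \<Rightarrow> (complex ^ 'a) set" where
  "supported S = {v. \<forall>A. A \<notin> S \<longrightarrow> v $ A = 0}"

definition coords :: "nat \<Rightarrow> (nat \<Rightarrow> 'a::finite) \<Rightarrow> complex ^ 'a \<Rightarrow> complex Matrix.vec" where
  "coords M b v = Matrix.vec M (\<lambda>k. v $ b k)"

text \<open>The matrix of the compression of \<open>F\<close> to the span of the blades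
  \<open>b 0\<close>, ..., \<open>b (M - 1)\<close>; components of the image along other blades are
  dropped.\<close>

definition coord_mat ::
  "nat \<Rightarrow> (nat \<Rightarrow> 'a::finite) \<Rightarrow> (complex ^ 'a \<Rightarrow> complex ^ 'a) \<Rightarrow> complex Matrix.mat" where
  "coord_mat M b F = Matrix.mat M M (\<lambda>(k, l). F (axis (b l) 1) $ b k)"

lemma supported_expansion:
  assumes b: "bij_betw b {0..<M} S" and v: "v \<in> supported S"
  shows "v = (\<Sum>l\<in>{0..<M}. v $ b l *s axis (b l) 1)"
proof -
  have "v = (\<Sum>A\<in>UNIV. v $ A *s axis A 1)"
    by (simp add: basis_expansion)
  also have "\<dots> = (\<Sum>A\<in>S. v $ A *s axis A 1)"
    using v by (intro sum.mono_neutral_right) (auto simp: supported_def)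
  also have "\<dots> = (\<Sum>l\<in>{0..<M}. v $ b l *s axis (b l) 1)"
    by (rule sum.reindex_bij_betw[OF b, symmetric])
  finally show ?thesis .
qed

lemma coord_mat_mult_coords:
  assumes b: "bij_betw b {0..<M} S" and v: "v \<in> supported S"
    and add: "\<And>u w. F (u + w) = F u + F w" and scale: "\<And>c u. F (c *s u) = c *s F u"
  shows "coord_mat M b F *\<^sub>v coords M b v = coords M b (F v)"
proof -
  have zero: "F 0 = 0"
    using scale[of 0 0] by simp
  have sum: "F (\<Sum>i\<in>I. G i) = (\<Sum>i\<in>I. F (G i))" for I and G :: "nat \<Rightarrow> _"
    by (induction I rule: infinite_finite_induct) (simp_all add: add zero)
  have "F v = (\<Sum>l\<in>{0..<M}. v $ b l *s F (axis (b l) 1))"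
    using arg_cong[where f = F, OF supported_expansion[OF b v]] unfolding sum scale .
  then have "F v $ A = (\<Sum>l\<in>{0..<M}. F (axis (b l) 1) $ A * v $ b l)" for A
    by (simp add: mult.commute)
  then show ?thesis
    by (intro eq_vecI) (simp_all add: coord_mat_def coords_def scalar_prod_def)
qed

lemma coords_add: "coords M b (u + v) = coords M b u + coords M b v"
  by (intro eq_vecI) (simp_all add: coords_def)

lemma coords_diff: "coords M b (u - v) = coords M b u - coords M b v"
  by (intro eq_vecI) (simp_all add: coords_def)

lemma coords_scale: "coords M b (c *s u) = c \<cdot>\<^sub>v coords M b u"
  by (intro eq_vecI) (simp_all add: coords_def)

lemma coords_carrier [simp]: "coords M b v \<in> carrier_vec M"
  by (simp add: coords_def)

lemma coords_sum:
  "finite I \<Longrightarrow> coords M b (\<Sum>i\<in>I. G i) = finsum_vec TYPE(complex) M (\<lambda>i. coords M b (G i)) I"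
proof (induction I rule: finite_induct)
  case empty
  show ?case unfolding finsum_vec_empty by (auto simp: coords_def)
next
  case (insert i I)
  then show ?case
    by (subst finsum_vec_insert) (auto simp: coords_add)
qed

text \<open>Blade coordinates turn \<open>hdot\<close> into the standard Hermitian product. Support
  of one argument suffices, since its zeros kill the remaining terms.\<close>

lemma scalar_prod_coords:
  assumes b: "bij_betw b {0..<M} S" and v: "v \<in> supported S"
  shows "coords M b u \<bullet>c coords M b v = hdot u v"
proof -
  have "coords M b u \<bullet>c coords M b v = (\<Sum>k\<in>{0..<M}. u $ b k * cnj (v $ b k))"
    by (simp add: scalar_prod_def coords_def)
  also have "\<dots> = (\<Sum>A\<in>S. u $ A * cnj (v $ A))"
    by (rule sum.reindex_bij_betw[OF b])
  also have "\<dots> = hdot u v"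
    unfolding hdot_def using v by (intro sum.mono_neutral_left) (auto simp: supported_def)
  finally show ?thesis .
qed

lemma bij_betw_coords:
  assumes b: "bij_betw b {0..<M} S"
  shows "bij_betw (coords M b) (supported S) (carrier_vec M)"
proof (rule bij_betwI')
  fix u v :: "complex ^ 'a" assume uv: "u \<in> supported S" "v \<in> supported S"
  show "coords M b u = coords M b v \<longleftrightarrow> u = v"
  proof
    assume "coords M b u = coords M b v"
    then have "u $ b k = v $ b k" if "k < M" for k
      using that by (metis coords_def index_vec)
    then have "(\<Sum>l\<in>{0..<M}. u $ b l *s axis (b l) 1) = (\<Sum>l\<in>{0..<M}. v $ b l *s axis (b l) 1)"
      by (intro sum.cong) auto
    then show "u = v"
      by (rule box_equals[OF _ supported_expansion[OF b uv(1), symmetric]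
            supported_expansion[OF b uv(2), symmetric]])
  qed simp
next
  fix x :: "complex Matrix.vec" assume x: "x \<in> carrier_vec M"
  \<comment> \<open>The preimage is the extension of \<open>x\<close> by zero to the blades outside
    \<open>S\<close>.\<close>
  let ?v = "\<chi> A. if A \<in> S then vec_index x (the_inv_into {0..<M} b A) else 0"
  have "the_inv_into {0..<M} b (b k) = k" "b k \<in> S" if "k < M" for k
    using b that by (auto simp: bij_betw_def intro!: the_inv_into_f_f)
  then have "coords M b ?v = x"
    using x by (intro eq_vecI) (simp_all add: coords_def)
  moreover have "?v \<in> supported S" by (simp add: supported_def)
  ultimately show "\<exists>v\<in>supported S. x = coords M b v" by metis
qed simp

lemma hermitian_coord_mat:
  assumes "\<And>u v. hdot (F u) v = hdot u (F v)"
  shows "hermitian_matrix (coord_mat M b F)"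
proof -
  \<comment> \<open>Entries are values of \<open>hdot\<close> against the orthonormal blades, so
    symmetry of \<open>F\<close> becomes conjugate symmetry of the matrix.\<close>
  have "cnj (F (axis B 1) $ A) = F (axis A 1) $ B" for A B
    by (metis assms hdot_axis_right hdot_cnj)
  then show ?thesis
    unfolding hermitian_matrix_def
    by (intro eq_matI) (auto simp: coord_mat_def mat_adjoint_def mat_of_rows_def)
qed

text \<open>The matrix represents the restriction to \<open>supported S\<close> of a form that is
  positive on the whole space.\<close>

lemma positive_definite_coord_mat:
  assumes b: "bij_betw b {0..<M} S"
    and add: "\<And>u w. F (u + w) = F u + F w" and scale: "\<And>c u. F (c *s u) = c *s F u"
    and pos: "\<And>u. u \<noteq> 0 \<Longrightarrow> inner (F u) u > 0"
  shows "positive_definite M (coord_mat M b F)"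
  unfolding positive_definite_def
proof (intro ballI impI)
  fix x :: "complex Matrix.vec" assume x: "x \<in> carrier_vec M" "x \<noteq> 0\<^sub>v M"
  obtain v where v: "v \<in> supported S" "x = coords M b v"
    using bij_betw_coords[OF b] x(1) by (metis bij_betw_imp_surj_on imageE)
  have "v \<noteq> 0" using x v by (auto simp: coords_def)
  then show "Re ((coord_mat M b F *\<^sub>v x) \<bullet>c x) > 0"
    unfolding v coord_mat_mult_coords[OF b v(1) add scale] scalar_prod_coords[OF b v(1)] Re_hdot
    by (rule pos)
qed

section \<open>Parity of multivectors\<close>

text \<open>The ordered products of generators are the coordinate blades, so grades are read off
  from cardinalities. The predicate \<open>p\<close> covers both parities.\<close>

lemma span_cliff_grade:
  "vec.span (\<Union>k\<in>{k. p k}. cliff_grade k) =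
    supported {A :: 'n::{finite,linorder} set. p (card A)}"
  (is "?L = supported ?S")
proof (intro equalityI)
  have subspace: "vec.subspace (supported ?S)"
    by (auto simp: vec.subspace_def supported_def)
  have "cliff_grade k \<subseteq> supported ?S" if "p k" for k
    unfolding cliff_grade_def generator_product_eq using that
    by (intro vec.span_minimal subspace) (auto simp: supported_def axis_def)
  then show "?L \<subseteq> supported ?S"
    by (intro vec.span_minimal subspace) blast
next
  show "supported ?S \<subseteq> ?L"
  proof
    fix v :: "'n multivector" assume v: "v \<in> supported ?S"
    have "axis A 1 \<in> ?L" if "p (card A)" for A :: "'n set"
      using that by (intro vec.span_base)
        (auto simp: cliff_grade_def generator_product_eq intro!: vec.span_base)
    then have "v $ A *s axis A 1 \<in> ?L" for A
      using v by (cases "p (card A)") (auto simp: supported_def intro: vec.span_scale vec.span_zero)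
    then have "(\<Sum>A\<in>UNIV. v $ A *s axis A 1) \<in> ?L"
      by (intro vec.span_sum)
    then show "v \<in> ?L" by (simp add: basis_expansion)
  qed
qed

lemma cliff_even_eq: "cliff_even = supported {A. even (card A)}"
  unfolding cliff_even_def span_cliff_grade ..

lemma cliff_odd_eq: "cliff_odd = supported {A. odd (card A)}"
  unfolding cliff_odd_def span_cliff_grade ..

lemma even_card_sym_diff_singleton:
  fixes A :: "'a::finite set"
  shows "even (card (sym_diff {a} A)) \<longleftrightarrow> odd (card A)"
proof (cases "a \<in> A")
  case True
  then have "sym_diff {a} A = A - {a}" by auto
  then show ?thesis
    using card_Suc_Diff1[OF finite True] by (metis even_Suc)
next
  case False
  then have "sym_diff {a} A = insert a A" by auto
  then show ?thesis
    using card_insert_disjoint[OF finite False] by (metis even_Suc)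
qed

text \<open>Up to sign, the coefficient of the product at \<open>A\<close> is that of
  \<open>v\<close> at \<open>sym_diff {a} A\<close>.\<close>

lemma generator_mult_supported:
  assumes "\<And>A. sym_diff {a} A \<in> S \<Longrightarrow> A \<in> S'" "v \<in> supported S"
  shows "generator a \<star> v \<in> supported S'"
proof -
  have "v $ sym_diff {a} A = 0" if "A \<notin> S'" for A
    using assms that unfolding supported_def by blast
  then show ?thesis
    unfolding supported_def generator_def mem_Collect_eq axis_cliff_mult_nth
    by (metis mult_zero_right)
qed

section \<open>Reduction to a Friedrichs system\<close>

lemma partial_deriv_nth:
  assumes "\<phi> differentiable (at x)"
  shows "partial_deriv i (\<lambda>z. (\<phi> z :: complex ^ 'a) $ A) x = partial_deriv i \<phi> x $ A"
proof -
  have "((\<lambda>z. \<phi> z $ A) has_derivative (\<lambda>v. frechet_derivative \<phi> (at x) v $ A)) (at x)"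
    using assms by (intro bounded_linear.has_derivative[OF bounded_linear_vec_nth]
        frechet_derivative_works[THEN iffD1])
  from frechet_derivative_at[OF this] show ?thesis
    by (metis partial_deriv_def)
qed

text \<open>A coefficient that vanishes identically has zero derivative. Thus derivatives of the
  unknown stay in its value space and are determined by their coordinates there.\<close>

lemma partial_deriv_supported:
  assumes "\<phi> differentiable (at x)" "\<And>z. \<phi> z \<in> supported S"
  shows "partial_deriv i \<phi> x \<in> supported S"
proof -
  have "partial_deriv i \<phi> x $ A = 0" if "A \<notin> S" for A
  proof -
    have "(\<lambda>z. \<phi> z $ A) = (\<lambda>z. 0)" using assms(2) that by (auto simp: supported_def)
    then show ?thesis
      using partial_deriv_nth[OF assms(1), of i A] by (simp add: partial_deriv_def)
  qed
  then show ?thesis by (simp add: supported_def)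
qed

lemma column_partial_deriv_coords:
  assumes "\<phi> differentiable (at x)"
  shows "column_partial_deriv M i (coords M b \<circ> \<phi>) x = coords M b (partial_deriv i \<phi> x)"
  unfolding column_partial_deriv_def
  by (intro eq_vecI) (simp_all add: coords_def partial_deriv_nth[OF assms])

lemma smooth_coord_mat:
  assumes "\<And>v. smooth (\<lambda>x. F x v)"
  shows "smooth_matrix M (\<lambda>x. coord_mat M b (F x))"
  using assms by (auto simp: smooth_matrix_def coord_mat_def intro: smooth_nth)

lemma smooth_tetrad_row:
  assumes "smooth_tetrad y"
  shows "(\<Sum>a\<in>UNIV. (y \<mu> a x)\<^sup>2 * eta a a) = eta \<mu> \<mu>"
proof -
  have "(\<Sum>b\<in>UNIV. y \<mu> a x * y \<mu> b x * eta a b) = (y \<mu> a x)\<^sup>2 * eta a a" for a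
  proof -
    have "(\<Sum>b\<in>UNIV. y \<mu> a x * y \<mu> b x * eta a b) =
        (\<Sum>b\<in>UNIV. if b = a then (y \<mu> a x)\<^sup>2 * eta a a else 0)"
      by (intro sum.cong) (auto simp: eta_def power2_eq_square)
    then show ?thesis by simp
  qed
  moreover have "(\<Sum>a\<in>UNIV. \<Sum>b\<in>UNIV. y \<mu> a x * y \<mu> b x * eta a b) = eta \<mu> \<mu>"
    using assms unfolding smooth_tetrad_def by blast
  ultimately show ?thesis by simp
qed

text \<open>By connectedness the range is an interval, and it avoids 0.\<close>

lemma sgn_constant:
  fixes f :: "'a::real_normed_vector \<Rightarrow> real"
  assumes "continuous_on UNIV f" "\<And>x. f x \<noteq> 0"
  shows "sgn (f x) = sgn (f x')"
proof -
  have "is_interval (range f)"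
    using assms(1) by (simp add: is_interval_connected_1 connected_continuous_image connected_UNIV)
  then have "0 \<in> range f" if "f u < 0" "f v > 0" for u v
    using that unfolding is_interval_1 by (meson less_imp_le rangeI)
  then show ?thesis
    using assms(2) by (smt (verit) imageE sgn_if)
qed

lemma smooth_tetrad_sgn:
  fixes y :: "'n::{finite,linorder} \<Rightarrow> 'n \<Rightarrow> 'n point \<Rightarrow> real"
  assumes "smooth_tetrad y"
  shows "sgn (y first_index first_index x) = sgn (y first_index first_index x')"
proof (rule sgn_constant[of "y first_index first_index"])
  show "continuous_on UNIV (y first_index first_index)"
    using assms by (simp add: smooth_tetrad_def smooth_imp_continuous_on)
next
  fix x
  have "1 = (\<Sum>a\<in>UNIV. (y first_index a x)\<^sup>2 * eta a a)"
    unfolding smooth_tetrad_row[OF assms] by (simp add: eta_def)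
  \<comment> \<open>Only the time component enters the row sum with a positive sign, so its square
    is at least 1.\<close>
  also have "\<dots> \<le> (\<Sum>a\<in>UNIV. if a = first_index then (y first_index a x)\<^sup>2 else 0)"
    by (intro sum_mono) (simp add: eta_def)
  also have "\<dots> = (y first_index first_index x)\<^sup>2" by simp
  finally show "y first_index first_index x \<noteq> 0" by auto
qed

theorem mainTheorem1:
  fixes y :: "'n::{finite,linorder} \<Rightarrow> 'n \<Rightarrow> 'n point \<Rightarrow> real"
    and A B :: "nat \<Rightarrow> 'n point \<Rightarrow> 'n multivector"
    and f :: "'n point \<Rightarrow> 'n multivector"
    and V W :: "'n multivector set"
    and N :: nat
  assumes "CARD('n) \<ge> 2" and "even CARD('n)"
    and "smooth_tetrad y"
    and "\<forall>j\<in>{1..N}. smooth (A j) \<and> smooth (B j)"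
    and "covariantly_equipped V W N A B f"
  shows "writable_as_friedrichs V W (\<lambda>\<phi> x. eth y \<phi> x + Q_op N A B \<phi> x - f x)"
proof -
  \<comment> \<open>All three cases become one: both spaces are spanned by blades, and toggling the
    first index exchanges the two sets of blades.\<close>
  have "\<exists>S S'. V = supported S \<and> W = supported S' \<and>
      (\<forall>C. sym_diff {first_index} C \<in> S \<longleftrightarrow> C \<in> S')"
  proof -
    consider "V = UNIV" "W = UNIV" | "V = cliff_even" "W = cliff_odd" | "V = cliff_odd" "W = cliff_even"
      using assms(5) by (auto simp: covariantly_equipped_def)
    then show ?thesis
    proof cases
      case 1
      then show ?thesis by (intro exI[of _ UNIV]) (auto simp: supported_def)
    next
      case 2
      then show ?thesis
        unfolding cliff_even_eq cliff_odd_eq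
        by (intro exI conjI) (assumption, assumption, simp only: mem_Collect_eq even_card_sym_diff_singleton simp_thms)
    next
      case 3
      then show ?thesis
        unfolding cliff_even_eq cliff_odd_eq
        by (intro exI conjI) (assumption, assumption, simp only: mem_Collect_eq even_card_sym_diff_singleton simp_thms)
    qed
  qed
  then obtain S S' where V: "V = supported S" and W: "W = supported S'"
    and S: "\<And>C. sym_diff {first_index} C \<in> S \<longleftrightarrow> C \<in> S'"
    by blast
  have S': "sym_diff {first_index} C \<in> S' \<longleftrightarrow> C \<in> S" for C
    unfolding S[symmetric] sym_diff_cancel ..
  define M where "M = card S"
  obtain b where b: "bij_betw b {0..<M} S"
    using ex_bij_betw_nat_finite[of S] by (auto simp: M_def)
  define s where "s = sgn (y first_index first_index 0)"
  have row: "(\<Sum>a\<in>UNIV. (y first_index a x)\<^sup>2 * eta a a) = 1" for x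
    unfolding smooth_tetrad_row[OF assms(3)] by (simp add: eta_def)
  have s: "s = sgn (y first_index first_index x)" for x
    unfolding s_def by (rule smooth_tetrad_sgn[OF assms(3)])
  have pos: "s * inner (e1 \<star> (genvector y first_index x \<star> u)) u > 0" if "u \<noteq> 0" for u x
    using inner_e1_slash_pos[OF row that] by (simp add: genvector_eq_slash s[of x])
  \<comment> \<open>Strict positivity at the nonzero multivector \<open>cliff_one\<close> excludes
    \<open>s = 0\<close>.\<close>
  have ss: "s * s = 1"
    using pos[of cliff_one] by (auto simp: s_def sgn_if cliff_one_def)
  \<comment> \<open>The symmetrizing multiplier. It is its own inverse and carries the values of the
    equation back to the space of the unknown.\<close>
  define J where "J w = of_real s *s (e1 \<star> w)" for w :: "'n multivector"
  have J_J: "J (J w) = w" for w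
    by (simp add: J_def cliff_mult_scale_right e1_e1 ss flip: of_real_mult)
  have J_add: "J (u + w) = J u + J w" and J_diff: "J (u - w) = J u - J w"
    and J_scale: "J (c *s u) = c *s J u" for u w c
  proof -
    show add: "J (u + w) = J u + J w" for u w
      by (simp add: J_def cliff_mult_add_right vec.scale_right_distrib)
    show "J (u - w) = J u - J w"
      using add[of "u - w" w] by (simp add: eq_diff_eq)
    show "J (c *s u) = c *s J u"
      by (simp add: J_def cliff_mult_scale_right mult.commute)
  qed
  have J_sum: "J (\<Sum>i\<in>I. G i) = (\<Sum>i\<in>I. J (G i))" for I :: "'n set" and G
    by (simp add: J_def cliff_mult_sum_right vec.scale_sum_right)
  have smooth_J: "smooth (\<lambda>x. J (F x))" if "smooth F" for F :: "'n point \<Rightarrow> _"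
    unfolding J_def by (intro smooth_scale bounded_bilinear.smooth_prod[OF bounded_bilinear_cliff_mult]
        smooth_const that)
  define T where "T = coords M b"
  \<comment> \<open>The coefficients of the system after multiplication by \<open>J\<close>, written
    in the blade basis of \<open>V\<close>.\<close>
  define H where "H i x = coord_mat M b (\<lambda>v. J (genvector y i x \<star> v))" for i x
  define P where "P x = coord_mat M b (\<lambda>v. J (\<Sum>j=1..N. A j x \<star> v \<star> B j x))" for x
  define g where "g x = T (J (f x))" for x

  have T: "linear_isomorphism V M T"
    using bij_betw_coords[OF b] by (simp add: linear_isomorphism_def T_def V coords_add coords_scale)
  have "bij_betw J W V"
  proof (rule bij_betw_byWitness[of _ J])
    have J_supported: "J w \<in> supported R'"
      if "\<And>C. sym_diff {first_index} C \<in> R \<Longrightarrow> C \<in> R'" "w \<in> supported R" for w R R'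
      using generator_mult_supported[of first_index R R' w, OF that]
      by (simp add: J_def supported_def)
    show "J ` W \<subseteq> V"
      unfolding V W image_subset_iff using S' by (intro ballI J_supported[of S']) (simp_all only:)
    show "J ` V \<subseteq> W"
      unfolding V W image_subset_iff using S by (intro ballI J_supported[of S]) (simp_all only:)
  qed (simp_all add: J_J)
  \<comment> \<open>The equation is first moved into \<open>V\<close> by \<open>J\<close>, so the
    coordinates \<open>T\<close> of the unknown serve for it as well.\<close>
  then have "bij_betw (T \<circ> J) W (carrier_vec M)"
    using T by (auto simp: linear_isomorphism_def intro: bij_betw_trans)
  then have L: "linear_isomorphism W M (T \<circ> J)"
    by (simp add: linear_isomorphism_def T_def J_add J_scale coords_add coords_scale)
  have "friedrichs_system M H P g"
    unfolding friedrichs_system_def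
  proof (intro conjI allI)
    show "smooth_matrix M (H i)" for i
      unfolding H_def genvector_def using assms(3)
      by (intro smooth_coord_mat smooth_J bounded_bilinear.smooth_prod[OF bounded_bilinear_cliff_mult]
        smooth_const smooth_sum smooth_scale_const) (simp add: smooth_tetrad_def)
    show "smooth_matrix M P"
      unfolding P_def using assms(4)
      by (intro smooth_coord_mat smooth_J bounded_bilinear.smooth_prod[OF bounded_bilinear_cliff_mult]
        smooth_const smooth_sum) auto
    show "g x \<in> carrier_vec M" for x
      by (simp add: g_def T_def)
    show "hermitian_matrix (H i x)" for i x
      unfolding H_def genvector_eq_slash
      by (rule hermitian_coord_mat) (simp add: J_def hdot_scale_left hdot_scale_right hdot_e1_slash)
    show "positive_definite M (H first_index x)" for x
      unfolding H_def
    proof (rule positive_definite_coord_mat[OF b])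
      show "inner (J (genvector y first_index x \<star> u)) u > 0" if "u \<noteq> 0" for u
        using pos[OF that] by (simp add: J_def flip: scaleR_eq_of_real_scale)
    qed (simp_all add: cliff_mult_add_right cliff_mult_scale_right J_add J_scale)
  qed
  moreover have "(T \<circ> J) (eth y \<phi> x + Q_op N A B \<phi> x - f x) = friedrichs_expression M H P g (T \<circ> \<phi>) x"
    if "genform_in V \<phi>" "\<phi> differentiable_on UNIV" for \<phi> x
  proof -
    have d: "\<phi> differentiable (at x)" using that by (simp add: differentiable_on_def)
    have \<phi>: "\<phi> z \<in> supported S" for z using that by (simp add: genform_in_def V)
    have "H i x *\<^sub>v column_partial_deriv M i (T \<circ> \<phi>) x = T (J (genvector y i x \<star> partial_deriv i \<phi> x))" for i
      unfolding T_def H_def column_partial_deriv_coords[OF d]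
      by (rule coord_mat_mult_coords[OF b partial_deriv_supported[OF d \<phi>]])
        (simp_all add: cliff_mult_add_right cliff_mult_scale_right J_add J_scale)
    moreover have "P x *\<^sub>v (T \<circ> \<phi>) x = T (J (Q_op N A B \<phi> x))"
      unfolding T_def P_def Q_op_def comp_def
      by (rule coord_mat_mult_coords[OF b \<phi>])
        (simp_all add: cliff_mult_add_right cliff_mult_add_left cliff_mult_scale_right
          cliff_mult_scale_left J_add[symmetric] J_scale[symmetric] sum.distrib vec.scale_sum_right)
    ultimately show ?thesis
      by (simp add: friedrichs_expression_def eth_def g_def J_add J_diff J_sum T_def coords_add
          coords_diff coords_sum)
  qed
  ultimately show ?thesis
    unfolding writable_as_friedrichs_def using T L
    \<comment> \<open>Since \<open>s\<close> is the same at all points, the isomorphism for the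
      equation is constant in x, and its smoothness is that of constants.\<close>
    by (intro exI[of _ M] exI[of _ T] exI[of _ "\<lambda>_. T \<circ> J"] exI[of _ H] exI[of _ P] exI[of _ g])
      (simp add: smooth_const)
qed

end
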